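(* (The Mean Value Theorem) Let $I$ be a nonempty open interval in $\mathbb{R}$, let $f:m_{\approx}(I)\to\widehat{\mathbb{R}}$ be an indiscernible extension of $\phi:I\to\mathbb{R}$, differentiable on $m_{\approx}(I)$, and suppose that $\lim_{\xi\to\xi_0}\frac{\phi(\xi)-\phi(\xi_0)}{\xi-\xi_0}$ exists in $\mathbb{R}$ for each $\xi_0\in I$. If $a,b\in m_{\approx}(I)$ and $a<b$, then there exists $\gamma\in I$ such that $a<\gamma<b$ and $$f(b)-f(a)=f'(\gamma)(b-a)+(f'(b)-f'(\gamma))\,db+(f'(\gamma)-f'(a))\,da.$$ In particular, if $a,b\in I$, then this identity assumes the form $f(b)-f(a)=f'(\gamma)(b-a)$. The previous identities stay valid when $\gamma$ is replaced by any $c\in m_{\approx}(\gamma)$.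
   Context: $\widehat{\mathbb{R}}$ is the set of all convergent sequences of real numbers; a real number is identified with the corresponding constant sequence, so $\mathbb{R}\subseteq\widehat{\mathbb{R}}$. $\sigma x\in\mathbb{R}$ is the limit of $x$; $x\approx y$ means $\sigma x=\sigma y$; $x<y$ means $\sigma x<\sigma y$; $dx:=x-\sigma x$. For $x=(\xi_n),y=(\eta_n)$: $x+y:=(\xi_n+\eta_n)$, $xy:=(\sigma x\,\eta_n+\sigma y\,\xi_n-\sigma x\,\sigma y)$. $m_{\approx}(x):=\{y\in\widehat{\mathbb{R}}\mid y\approx x\}$ and $m_{\approx}(A):=\bigcup_{x\in A}m_{\approx}(x)$ for $A\subseteq\widehat{\mathbb{R}}$. A function $f:m_{\approx}(I)\to\widehat{\mathbb{R}}$ is an indiscernible extension of $\phi:I\to\mathbb{R}$ iff $f(\sigma x)=\phi(\sigma x)$ and $f(x)\approx\phi(\sigma x)$ for all $x\in m_{\approx}(I)$. Such an $f$ is differentiable at $\xi_0\in I$ iff there is a real number $\alpha$ with $f(x)=\phi(\xi_0)+\alpha\,dx$ for all $x\in m_{\approx}(\xi_0)$, with the proviso that $\alpha=\lim_{\xi\to\xi_0}\frac{\phi(\xi)-\phi(\xi_0)}{\xi-\xi_0}$ whenever this (usual) limit exists in $\mathbb{R}$. This $\alpha$ is unique and, for each $x\in m_{\approx}(\xi_0)$, it is called the derivative of $f$ at $x$ and denoted $f'(x)$. $f$ is differentiable on $m_{\approx}(I)$ iff it is differentiable at each $\xi_0\in I$. *)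

theory Defs
  imports "HOL-Analysis.Analysis"
begin

typedef convseq = "{x :: nat \<Rightarrow> real. convergent x}"
  morphisms seq Abs_convseq
  by (auto intro: convergent_const)

setup_lifting type_definition_convseq

text \<open>Constant sequences; this is the identification of the reals with a subset of
  \<^typ>\<open>convseq\<close>.\<close>

lift_definition cst :: "real \<Rightarrow> convseq" is "\<lambda>r _. r"
  by (rule convergent_const)

definition st :: "convseq \<Rightarrow> real" where
  "st x = lim (seq x)"

lemma seq_LIMSEQ: "seq x \<longlonglongrightarrow> st x"
  using seq[of x] by (simp add: st_def convergent_LIMSEQ_iff)

lemma st_unique: "seq x \<longlonglongrightarrow> l \<Longrightarrow> st x = l"
  using LIMSEQ_unique seq_LIMSEQ by blast

lemma convseq_eqI: "(\<And>n. seq x n = seq y n) \<Longrightarrow> x = y"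
  by (metis ext seq_inject)

text \<open>Sums are termwise, but the product is not: it is linearised around the limits, so that
  a product of two null sequences is zero.\<close>

instantiation convseq :: comm_ring_1
begin

lift_definition zero_convseq :: convseq is "\<lambda>_. 0"
  by (rule convergent_const)

lift_definition one_convseq :: convseq is "\<lambda>_. 1"
  by (rule convergent_const)

lift_definition plus_convseq :: "convseq \<Rightarrow> convseq \<Rightarrow> convseq" is "\<lambda>x y n. x n + y n"
  by (rule convergent_add)

lift_definition minus_convseq :: "convseq \<Rightarrow> convseq \<Rightarrow> convseq" is "\<lambda>x y n. x n - y n"
  by (rule convergent_diff)

lift_definition uminus_convseq :: "convseq \<Rightarrow> convseq" is "\<lambda>x n. - x n"
  by (simp add: convergent_minus_iff[symmetric])

lift_definition times_convseq :: "convseq \<Rightarrow> convseq \<Rightarrow> convseq" is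
  "\<lambda>x y n. lim x * y n + lim y * x n - lim x * lim y"
  by (intro convergent_add convergent_diff convergent_mult convergent_const)

lemma seq_times: "seq (x * y) n = st x * seq y n + st y * seq x n - st x * st y"
  by (simp add: times_convseq.rep_eq st_def)

lemma st_times: "st (x * y) = st x * st y"
proof (rule st_unique)
  have "(\<lambda>n. st x * seq y n + st y * seq x n - st x * st y) \<longlonglongrightarrow>
      st x * st y + st y * st x - st x * st y"
    by (intro tendsto_intros seq_LIMSEQ)
  then show "seq (x * y) \<longlonglongrightarrow> st x * st y"
    by (simp add: seq_times[abs_def] algebra_simps)
qed

lemma st_plus: "st (x + y) = st x + st y"
  by (rule st_unique) (auto simp: plus_convseq.rep_eq intro!: tendsto_add seq_LIMSEQ)

lemma st_one: "st 1 = 1"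
  by (rule st_unique) (simp add: one_convseq.rep_eq)

instance
proof
  fix a b c :: convseq
  show "a * b * c = a * (b * c)"
    by (rule convseq_eqI) (simp add: seq_times st_times algebra_simps)
  show "a * b = b * a"
    by (rule convseq_eqI) (simp add: seq_times algebra_simps)
  show "1 * a = a"
    by (rule convseq_eqI) (simp add: seq_times st_one one_convseq.rep_eq)
  show "(a + b) * c = a * c + b * c"
    by (rule convseq_eqI) (simp add: seq_times st_plus plus_convseq.rep_eq algebra_simps)
  show "(0 :: convseq) \<noteq> 1"
    by transfer (simp add: fun_eq_iff)
qed (transfer; simp add: fun_eq_iff)+

end

lemma st_cst: "st (cst r) = r"
  by (rule st_unique) (simp add: cst.rep_eq)

text \<open>Note that the order compares limits only, so \<^prop>\<open>x \<le> y\<close> and \<^prop>\<open>y \<le> x\<close> give equal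
  limits rather than equality.\<close>

instantiation convseq :: preorder
begin

definition less_convseq :: "convseq \<Rightarrow> convseq \<Rightarrow> bool" where
  "x < y \<longleftrightarrow> st x < st y"

definition less_eq_convseq :: "convseq \<Rightarrow> convseq \<Rightarrow> bool" where
  "x \<le> y \<longleftrightarrow> st x \<le> st y"

instance
  by standard (auto simp: less_convseq_def less_eq_convseq_def)

end

definition indisc :: "convseq \<Rightarrow> convseq \<Rightarrow> bool" where
  "indisc x y \<longleftrightarrow> st x = st y"

definition dd :: "convseq \<Rightarrow> convseq" where
  "dd x = x - cst (st x)"

definition monad :: "convseq \<Rightarrow> convseq set" where
  "monad x = {y. indisc y x}"

definition monad_set :: "convseq set \<Rightarrow> convseq set" where
  "monad_set A = (\<Union>x\<in>A. monad x)"

text \<open>Functions on \<open>monad_set (cst ` I)\<close> and on \<open>I\<close> are total functions whose values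
  elsewhere play no role.\<close>

definition indisc_extension ::
    "real set \<Rightarrow> (real \<Rightarrow> real) \<Rightarrow> (convseq \<Rightarrow> convseq) \<Rightarrow> bool" where
  "indisc_extension I \<phi> f \<longleftrightarrow>
     (\<forall>x\<in>monad_set (cst ` I). f (cst (st x)) = cst (\<phi> (st x)) \<and> indisc (f x) (cst (\<phi> (st x))))"

text \<open>The limit is taken within \<open>I\<close> because \<open>\<phi>\<close> is only meaningful there; for open \<open>I\<close> this is
  the ordinary two-sided limit.\<close>

definition diff_quotient_tendsto ::
    "real set \<Rightarrow> (real \<Rightarrow> real) \<Rightarrow> real \<Rightarrow> real \<Rightarrow> bool" where
  "diff_quotient_tendsto I \<phi> \<xi>0 L \<longleftrightarrow>
     ((\<lambda>\<xi>. (\<phi> \<xi> - \<phi> \<xi>0) / (\<xi> - \<xi>0)) \<longlongrightarrow> L) (at \<xi>0 within I)"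

definition has_indisc_derivative ::
    "real set \<Rightarrow> (real \<Rightarrow> real) \<Rightarrow> (convseq \<Rightarrow> convseq) \<Rightarrow> real \<Rightarrow> real \<Rightarrow> bool" where
  "has_indisc_derivative I \<phi> f \<xi>0 \<alpha> \<longleftrightarrow>
     (\<forall>x\<in>monad (cst \<xi>0). f x = cst (\<phi> \<xi>0) + cst \<alpha> * dd x) \<and>
     (\<forall>L. diff_quotient_tendsto I \<phi> \<xi>0 L \<longrightarrow> \<alpha> = L)"

definition indisc_differentiable_at ::
    "real set \<Rightarrow> (real \<Rightarrow> real) \<Rightarrow> (convseq \<Rightarrow> convseq) \<Rightarrow> real \<Rightarrow> bool" where
  "indisc_differentiable_at I \<phi> f \<xi>0 \<longleftrightarrow> (\<exists>\<alpha>. has_indisc_derivative I \<phi> f \<xi>0 \<alpha>)"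

definition indisc_differentiable ::
    "real set \<Rightarrow> (real \<Rightarrow> real) \<Rightarrow> (convseq \<Rightarrow> convseq) \<Rightarrow> bool" where
  "indisc_differentiable I \<phi> f \<longleftrightarrow> (\<forall>\<xi>0\<in>I. indisc_differentiable_at I \<phi> f \<xi>0)"

text \<open>The derivative at \<open>x\<close> is that at the limit of \<open>x\<close>, viewed as a constant sequence.\<close>

definition indisc_deriv ::
    "real set \<Rightarrow> (real \<Rightarrow> real) \<Rightarrow> (convseq \<Rightarrow> convseq) \<Rightarrow> convseq \<Rightarrow> convseq" where
  "indisc_deriv I \<phi> f x = cst (THE \<alpha>. has_indisc_derivative I \<phi> f (st x) \<alpha>)"

lemma has_indisc_derivative_unique:
  assumes "has_indisc_derivative I \<phi> f \<xi>0 \<alpha>" "has_indisc_derivative I \<phi> f \<xi>0 \<beta>"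
  shows "\<alpha> = \<beta>"
proof -
  have lim: "(\<lambda>n. \<xi>0 + inverse (real (Suc n))) \<longlonglongrightarrow> \<xi>0"
    using LIMSEQ_inverse_real_of_nat_add .
  define x where "x = Abs_convseq (\<lambda>n. \<xi>0 + inverse (real (Suc n)))"
  have seq_x: "seq x = (\<lambda>n. \<xi>0 + inverse (real (Suc n)))"
    unfolding x_def using lim by (intro Abs_convseq_inverse) (auto simp: convergent_def)
  have st_x: "st x = \<xi>0"
    by (rule st_unique) (use lim seq_x in simp)
  have "x \<in> monad (cst \<xi>0)"
    by (simp add: monad_def indisc_def st_x st_cst)
  then have "cst (\<phi> \<xi>0) + cst \<alpha> * dd x = cst (\<phi> \<xi>0) + cst \<beta> * dd x"
    using assms unfolding has_indisc_derivative_def by metis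
  then have eq: "seq (cst \<alpha> * dd x) 0 = seq (cst \<beta> * dd x) 0"
    by simp
  have "seq (dd x) = (\<lambda>n. inverse (real (Suc n)))"
    by (simp add: dd_def minus_convseq.rep_eq seq_x st_x cst.rep_eq)
  moreover from this have "st (dd x) = 0"
    by (intro st_unique) (simp only: LIMSEQ_inverse_real_of_nat)
  ultimately show ?thesis
    using eq by (simp add: seq_times st_cst)
qed

lemma indisc_deriv_eq:
  "has_indisc_derivative I \<phi> f (st x) \<alpha> \<Longrightarrow> indisc_deriv I \<phi> f x = cst \<alpha>"
  unfolding indisc_deriv_def
  by (metis has_indisc_derivative_unique the_equality)

end

theory Submission
  imports Defs
begin

text \<open>On the monad of a point of \<open>I\<close> the function \<open>f\<close> is affine in \<open>dx\<close>, so
  \<open>f(b) - f(a)\<close> is \<open>\<phi>(\<sigma>b) - \<phi>(\<sigma>a) + f'(b) db - f'(a) da\<close>. The proviso on the derivative forces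
  \<open>f'(x) = \<phi>'(\<sigma>x)\<close>, so the classical mean value theorem rewrites the real increment as
  \<open>f'(\<gamma>)(\<sigma>b - \<sigma>a)\<close>. Since \<open>\<sigma>b - \<sigma>a = (b - a) - db + da\<close>, the claim is a ring identity.\<close>

lemma cst_diff: "cst (r - s) = cst r - cst s"
  by transfer simp

text \<open>For constants the linearised product collapses:
  \<open>r * s + s * r - r * s = r * s\<close>.\<close>

lemma cst_mult: "cst (r * s) = cst r * cst s"
  by (rule convseq_eqI) (simp add: seq_times st_cst cst.rep_eq)

lemma dd_cst: "dd (cst r) = 0"
  by (simp add: dd_def st_cst)

lemma st_mem_if_monad_set_cst: "x \<in> monad_set (cst ` I) \<Longrightarrow> st x \<in> I"
  by (auto simp: monad_set_def monad_def indisc_def st_cst)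

text \<open>The proviso identifies \<open>\<alpha>\<close> with the limit of the difference
  quotients; openness of \<open>I\<close> turns the limit within \<open>I\<close> into the two-sided
  one.\<close>

lemma indisc_derivative_has_field_derivative:
  assumes "open I" "\<xi> \<in> I" "has_indisc_derivative I \<phi> f \<xi> \<alpha>"
    and "diff_quotient_tendsto I \<phi> \<xi> L"
  shows "(\<phi> has_field_derivative \<alpha>) (at \<xi>)"
proof -
  have "\<alpha> = L"
    using assms(3,4) by (auto simp: has_indisc_derivative_def)
  then have "(\<phi> has_field_derivative \<alpha>) (at \<xi> within I)"
    using assms(4) by (simp add: diff_quotient_tendsto_def has_field_derivative_iff)
  then show ?thesis
    by (simp only: at_within_open[OF assms(2,1)])
qed

text \<open>Every \<open>x\<close> lies in the monad of its own limit.\<close>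

lemma has_indisc_derivative_affine:
  assumes "has_indisc_derivative I \<phi> f (st x) \<alpha>"
  shows "f x = cst (\<phi> (st x)) + cst \<alpha> * dd x"
  using assms by (simp add: has_indisc_derivative_def monad_def indisc_def st_cst)

theorem theorem5p25:
  fixes I :: "real set" and \<phi> :: "real \<Rightarrow> real" and f :: "convseq \<Rightarrow> convseq"
    and a b :: convseq
  assumes "I \<noteq> {}" and "open I" and "is_interval I"
    and "indisc_extension I \<phi> f"
    and "indisc_differentiable I \<phi> f"
    and "\<forall>\<xi>0\<in>I. \<exists>L. diff_quotient_tendsto I \<phi> \<xi>0 L"
    and "a \<in> monad_set (cst ` I)" and "b \<in> monad_set (cst ` I)" and "a < b"
  shows "\<exists>\<gamma>\<in>I. a < cst \<gamma> \<and> cst \<gamma> < b \<and>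
    f b - f a = indisc_deriv I \<phi> f (cst \<gamma>) * (b - a)
      + (indisc_deriv I \<phi> f b - indisc_deriv I \<phi> f (cst \<gamma>)) * dd b
      + (indisc_deriv I \<phi> f (cst \<gamma>) - indisc_deriv I \<phi> f a) * dd a \<and>
    (a \<in> cst ` I \<and> b \<in> cst ` I \<longrightarrow>
      f b - f a = indisc_deriv I \<phi> f (cst \<gamma>) * (b - a)) \<and>
    (\<forall>c\<in>monad (cst \<gamma>).
      f b - f a = indisc_deriv I \<phi> f c * (b - a)
        + (indisc_deriv I \<phi> f b - indisc_deriv I \<phi> f c) * dd b
        + (indisc_deriv I \<phi> f c - indisc_deriv I \<phi> f a) * dd a \<and>
      (a \<in> cst ` I \<and> b \<in> cst ` I \<longrightarrow>
        f b - f a = indisc_deriv I \<phi> f c * (b - a)))"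
proof -
  \<comment> \<open>\<open>D\<close> is a real-valued choice of derivatives on \<open>I\<close>, to
    which the classical theorem can be applied.\<close>
  obtain D where D: "has_indisc_derivative I \<phi> f \<xi> (D \<xi>)" if "\<xi> \<in> I" for \<xi>
    using assms(5) unfolding indisc_differentiable_def indisc_differentiable_at_def by metis
  have deriv: "indisc_deriv I \<phi> f x = cst (D (st x))" if "st x \<in> I" for x
    using indisc_deriv_eq D that by blast
  have ab: "st a \<in> I" "st b \<in> I" "st a < st b"
    using assms(7-9) by (auto simp: st_mem_if_monad_set_cst less_convseq_def)
  have mem: "\<xi> \<in> I" if "st a \<le> \<xi>" "\<xi> \<le> st b" for \<xi>
    using mem_is_interval_1_I[OF assms(3) ab(1,2)] that by blast
  have "(\<phi> has_field_derivative D \<xi>) (at \<xi>)" if "st a \<le> \<xi>" "\<xi> \<le> st b" for \<xi>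
    using indisc_derivative_has_field_derivative[OF assms(2) _ D] assms(6) mem[OF that] by blast
  then obtain \<gamma> where \<gamma>: "st a < \<gamma>" "\<gamma> < st b" "\<phi> (st b) - \<phi> (st a) = (st b - st a) * D \<gamma>"
    using MVT2[OF ab(3), of \<phi> D] by blast
  have \<gamma>I: "\<gamma> \<in> I"
    using mem \<gamma> by simp
  \<comment> \<open>The real mean value identity is carried into the ring by
    \<open>cst\<close>.\<close>
  have increment: "cst (\<phi> (st b)) - cst (\<phi> (st a)) = (cst (st b) - cst (st a)) * cst (D \<gamma>)"
    using arg_cong[OF \<gamma>(3), of cst] by (simp add: cst_diff cst_mult)
  have "f b - f a = (cst (st b) - cst (st a)) * cst (D \<gamma>)
      + cst (D (st b)) * dd b - cst (D (st a)) * dd a"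
    unfolding increment[symmetric]
    using has_indisc_derivative_affine[OF D[OF ab(1)]] has_indisc_derivative_affine[OF D[OF ab(2)]]
    by simp
  then have main: "f b - f a = cst (D \<gamma>) * (b - a)
      + (cst (D (st b)) - cst (D \<gamma>)) * dd b + (cst (D \<gamma>) - cst (D (st a))) * dd a"
    by (simp add: dd_def algebra_simps)
  \<comment> \<open>Constants have zero differential, so both correction terms vanish.\<close>
  have real_case: "f b - f a = cst (D \<gamma>) * (b - a)" if "a \<in> cst ` I \<and> b \<in> cst ` I"
  proof -
    have "dd a = 0" "dd b = 0"
      using that by (auto simp: dd_cst)
    then show ?thesis
      using main by simp
  qed
  \<comment> \<open>The derivative depends only on the limit of its argument, so any such
    \<open>c\<close> can replace \<open>cst \<gamma>\<close>.\<close>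
  have st_c: "st c = \<gamma>" if "c \<in> monad (cst \<gamma>)" for c
    using that by (simp add: monad_def indisc_def st_cst)
  show ?thesis
    using \<gamma>I \<gamma>(1,2) main real_case ab(1,2)
    by (intro bexI[of _ \<gamma>]) (simp_all add: less_convseq_def st_cst deriv st_c)
qed

end
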